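(* Let $p$ be a prime number, let $\theta\in\mathbb{F}_{p^{p}}$ satisfy $\theta^{p}=\theta+1$, and let $\mathrm{Tr}:\mathbb{F}_{p^{p}}\to\mathbb{F}_{p}$ be the trace map. Let $a,m\in\mathbb{Z}_{\geq 0}$ with $\gcd(a,p)=1$, and put $\tau_{p}(a):=\sum_{j=1}^{p-1} j\,p^{ja-1}$. Then \[ a^{m}b_{m}(a^{-1}) \equiv -\mathrm{Tr}(\theta^{\tau_{p}(a)})\,\mathrm{Tr}(\theta^{m-1-\tau_{p}(a)}) \pmod{p}. \] In particular, $\mathrm{Tr}(\theta^{\zeta(\mathbb{F}_{p}, a)}) \equiv \mathrm{Tr}(\theta^{\tau_{p}(a)}) \equiv a^{\tau_{p}(a)}b_{\tau_{p}(a)}(a^{-1}) \pmod{p}$.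
   Context: $S(n,j)$ is the Stirling number of the second kind (number of partitions of $\{1,\dots,n\}$ into $j$ non-empty subsets) and $b_n(x):=\sum_{j\ge0}S(n,j)x^j\in\mathbb{Z}[x]$ is the Bell polynomial. $a^{-1}$ denotes the inverse of $a$ modulo $p$, and both sides are viewed in $\mathbb{F}_p$. Negative powers of $\theta$ are taken in $\mathbb{F}_{p^p}^\times$. Put $k_{p}:=(p^{p}-1)/(p-1)$; one has $\theta^{k_p}=1$. Since $p$ is a unit modulo $k_p$ and $1-p^{-a}$ is a unit modulo $k_p$ when $\gcd(a,p)=1$, $\zeta(\mathbb{F}_{p},a):=(1-p^{-a})^{-1}$ is a well-defined class in $\mathbb{Z}/k_p\mathbb{Z}$ and $\theta^{\zeta(\mathbb{F}_{p},a)}:=\theta^{Z}$ for any integer $Z$ in that class. *)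

theory Defs
  imports
    "HOL-Combinatorics.Stirling"
    "HOL-Computational_Algebra.Computational_Algebra"
    "HOL-Number_Theory.Number_Theory"
begin

hide_const (open) up_ring.monom up_ring.coeff

definition bell_poly :: "nat \<Rightarrow> int poly" where
  "bell_poly n = (\<Sum>j\<le>n. monom (int (Stirling n j)) j)"

text \<open>The truncation of the sum at \<open>n\<close> is harmless.\<close>

lemma coeff_bell_poly: "coeff (bell_poly n) j = int (Stirling n j)"
  by (simp add: bell_poly_def coeff_sum)

definition tau :: "nat \<Rightarrow> nat \<Rightarrow> nat" where
  "tau p a = (\<Sum>j=1..p-1. j * p ^ (j * a - 1))"

text \<open>
  The trace of the degree \<open>p\<close> extension of \<open>F\<^sub>p\<close>, as the sum of the
  Galois conjugates. \<open>F\<^sub>p\<close> is identified with the prime subfield of \<^typ>\<open>'a\<close>,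
  i.e. the range of \<^const>\<open>of_nat\<close>, in which the trace takes its values
  (\<open>Tr_in_prime_subfield\<close> below).
\<close>

definition Tr :: "nat \<Rightarrow> 'a :: finite_field \<Rightarrow> 'a" where
  "Tr p x = (\<Sum>i<p. x ^ (p ^ i))"

definition kp :: "nat \<Rightarrow> int" where
  "kp p = (int p ^ p - 1) div (int p - 1)"

text \<open>
  A representative of the class \<open>\<zeta>(F\<^sub>p, a) = (1 - p\<^sup>-\<^sup>a)\<^sup>-\<^sup>1\<close>
  in \<open>\<int>/k\<^sub>p\<int>\<close>. Both inverses exist if \<open>p\<close> is prime and coprime to \<open>a\<close>,
  see \<open>coprime_p_kp\<close> and \<open>coprime_one_minus_kp\<close> below.
\<close>

definition zeta :: "nat \<Rightarrow> nat \<Rightarrow> int" where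
  "zeta p a = modular_inverse (kp p) (1 - modular_inverse (kp p) (int p) ^ a)"

lemma CHAR_eq_if_card:
  assumes "prime p" "card (UNIV :: 'a :: finite_field set) = p ^ p"
  shows   "CHAR('a) = p"
proof -
  have "CHAR('a) dvd p ^ p"
    using CHAR_dvd_CARD[where 'a = 'a] assms(2) by simp
  moreover have "prime CHAR('a)"
    by (simp add: finite_imp_CHAR_pos prime_CHAR_semidom)
  ultimately show ?thesis
    using assms(1) by (metis prime_dvd_power primes_dvd_imp_eq)
qed

lemma Tr_in_prime_subfield:
  fixes x :: "'a :: finite_field"
  assumes p: "prime p" and card: "card (UNIV :: 'a set) = p ^ p"
  shows   "Tr p x \<in> range of_nat"
proof -
  have char: "CHAR('a) = p"
    by (rule CHAR_eq_if_card[OF p card])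
  have prime_char: "prime CHAR('a)" using p char by simp
  have fixed: "Tr p x ^ p = Tr p x"
  proof -
    have "Tr p x ^ p = (\<Sum>i<p. (x ^ (p ^ i)) ^ p)"
      unfolding Tr_def by (rule freshmans_dream_sum[OF prime_char char[symmetric]])
    also have "\<dots> = (\<Sum>i<p. x ^ (p ^ Suc i))"
      by (simp add: power_mult [symmetric] mult.commute)
    also have "\<dots> = Tr p x + x ^ (p ^ p) - x"
      using sum.lessThan_Suc_shift[of "\<lambda>i. x ^ (p ^ i)" p]
            sum.lessThan_Suc[of "\<lambda>i. x ^ (p ^ i)" p]
      unfolding Tr_def by (simp add: algebra_simps del: power_Suc)
    also have "x ^ (p ^ p) = x"
      using finite_field_power_card_eq_same[of x] card by simp
    finally show ?thesis by simp
  qed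
  define f :: "'a poly" where "f = monom 1 p - monom 1 1"
  have p1: "p > 1" using p prime_gt_1_nat by blast
  have "coeff f p = 1" using p1 by (simp add: f_def)
  hence f0: "f \<noteq> 0" by auto
  have deg: "degree f \<le> p"
    unfolding f_def using p1 by (intro degree_diff_le) (auto simp: degree_monom_eq)
  have root: "poly f y = 0 \<longleftrightarrow> y ^ p = y" for y
    by (simp add: f_def poly_monom)
  have fin: "finite {y. poly f y = 0}"
    using f0 by (rule poly_roots_finite)
  have inj: "inj_on (of_nat :: nat \<Rightarrow> 'a) {..<p}"
    by (auto intro!: inj_onI simp: of_nat_eq_iff_cong_CHAR char cong_def)
  have nat_root: "(of_nat n :: 'a) ^ p = of_nat n" for n
  proof (induction n)
    case 0
    then show ?case using p1 by simp
  next
    case (Suc n)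
    have "(of_nat n + 1 :: 'a) ^ p = of_nat n ^ p + 1 ^ p"
      by (rule freshmans_dream[OF prime_char char[symmetric]])
    thus ?case using Suc by (simp add: add.commute)
  qed
  have sub: "of_nat ` {..<p} \<subseteq> {y. poly f y = 0}"
    by (auto simp: root nat_root)
  have "card {y. poly f y = 0} \<le> card (of_nat ` {..<p} :: 'a set)"
    using card_poly_roots_bound[OF f0] deg by (simp add: card_image[OF inj])
  hence "of_nat ` {..<p} = {y. poly f y = 0}"
    using card_seteq[OF fin sub] by simp
  with fixed show ?thesis
    by (auto simp: root set_eq_iff)
qed

lemma kp_eq_sum: "p > 1 \<Longrightarrow> kp p = (\<Sum>i<p. int p ^ i)"
  unfolding kp_def power_diff_1_eq by simp

lemma coprime_p_kp:
  assumes "p > 1"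
  shows   "coprime (int p) (kp p)"
proof -
  obtain n where n: "p = Suc n"
    using assms by (cases p) auto
  have "kp p = 1 + int p * (\<Sum>i<n. int p ^ i)"
    using assms unfolding kp_eq_sum[OF assms]
    by (subst (2) n, subst sum.lessThan_Suc_shift) (simp add: sum_distrib_left)
  thus ?thesis
    by (metis coprime_iff_gcd_eq_1 gcd_add_mult gcd_1_int mult.commute add.commute gcd.commute)
qed

lemma coprime_one_minus_kp:
  assumes p: "prime p" and cop: "coprime a p"
  shows   "coprime (1 - modular_inverse (kp p) (int p) ^ a) (kp p)"
proof (rule ccontr)
  define P where "P = modular_inverse (kp p) (int p)"
  have p1: "p > 1" using p prime_gt_1_nat by blast
  assume "\<not> coprime (1 - modular_inverse (kp p) (int p) ^ a) (kp p)"
  define d where "d = gcd (1 - P ^ a) (kp p)"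
  have "kp p > 0"
    unfolding kp_eq_sum[OF p1] using p1 by (intro sum_pos) auto
  hence "d \<noteq> 0" by (simp add: d_def)
  moreover have "\<not> is_unit d"
    using \<open>\<not> coprime _ _\<close> by (simp add: d_def P_def is_unit_gcd_iff coprime_iff_gcd_eq_1)
  ultimately obtain q where "prime q" "q dvd d"
    using prime_divisorE by blast
  hence q: "prime q" "q dvd 1 - P ^ a" "q dvd kp p"
    unfolding d_def by simp_all
  define r where "r = nat q"
  have r: "q = int r"
    using q(1) by (simp add: r_def prime_ge_0_int)
  have "[int p * P = 1] (mod q)"
    using cong_modular_inverse1[OF coprime_p_kp[OF p1]] q(3) unfolding P_def
    using cong_dvd_modulus by blast
  hence "[(int p * P) ^ a = 1 ^ a] (mod q)" by (rule cong_pow)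
  moreover have "[P ^ a = 1] (mod q)"
    using q(2) by (simp add: cong_iff_dvd_diff dvd_diff_commute)
  hence "[int p ^ a * P ^ a = int p ^ a * 1] (mod q)" by (intro cong_mult cong_refl)
  ultimately have 1: "[int p ^ a = 1] (mod q)"
    unfolding power_mult_distrib power_one mult_1_right using cong_sym cong_trans by blast
  have "int p ^ p - 1 = (int p - 1) * kp p"
    unfolding kp_eq_sum[OF p1] by (rule power_diff_1_eq)
  hence 2: "[int p ^ p = 1] (mod q)"
    using q(3) by (simp add: cong_iff_dvd_diff)
  have "[p ^ a = 1] (mod r)" "[p ^ p = 1] (mod r)"
    using 1 2 unfolding r by (simp_all flip: cong_int_iff)
  hence "ord r p dvd a" "ord r p dvd p"
    by (simp_all only: ord_divides)
  hence "ord r p = 1"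
    using cop by (metis coprime_common_divisor_nat)
  hence "[p = 1] (mod r)"
    using ord[of p r] by simp
  hence 3: "[int p = 1] (mod q)"
    unfolding r by (simp flip: cong_int_iff)
  have "[kp p = (\<Sum>i<p. 1 ^ i)] (mod q)"
    unfolding kp_eq_sum[OF p1] by (intro cong_sum cong_pow 3)
  hence "[int p = 0] (mod q)"
    using q(3) by (simp add: cong_0_iff cong_dvd_iff)
  with 3 have "[1 = 0] (mod q)"
    using cong_sym cong_trans by blast
  thus False using q(1) by (simp add: cong_0_iff not_prime_unit)
qed

lemma zeta_mult_eq_1:
  assumes "prime p" "coprime a p"
  shows   "[(1 - modular_inverse (kp p) (int p) ^ a) * zeta p a = 1] (mod kp p)"
  unfolding zeta_def by (rule cong_modular_inverse1[OF coprime_one_minus_kp[OF assms]])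

end

theory Submission
  imports Defs
begin

text \<open>
  Let \<open>u = \<theta>\<^sup>\<tau>\<close>. Summation by parts gives \<open>\<tau> (p\<^sup>a - 1) \<equiv> 1\<close> modulo \<open>k\<^sub>p\<close>, so
  \<open>\<sigma> = Frob\<^sup>a\<close>, which maps \<open>\<theta>\<close> to \<open>\<theta> + a\<close>, satisfies \<open>\<sigma> u = u \<theta>\<close>. Hence the conjugates of \<open>u\<close>
  are \<open>u (\<Prod>i<j. \<theta> + i a)\<close> for \<open>j < p\<close>. As \<open>\<Prod>1\<le>i<j. \<theta> + i a\<close> has trace \<open>0\<close> for \<open>1 \<le> j < p\<close>
  (it is a multiple of some \<open>\<sigma> h - h\<close>) and \<open>Tr (1 / \<theta>) = -1\<close>, summing gives
  \<open>Tr u \<cdot> Tr (1 / (u \<theta>)) = -1\<close>. Therefore \<open>M x = - Tr u \<cdot> Tr (x / (u \<theta>))\<close> satisfies \<open>M 1 = 1\<close> and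
  \<open>M (\<theta> x) = M (\<sigma> x)\<close>, so that \<open>M\<close> takes the value \<open>1\<close> on every \<open>\<Prod>i<j. \<theta> - i a\<close>, and expanding
  \<open>\<theta>\<^sup>m\<close> in these products with Stirling numbers gives the Bell polynomial. Finally \<open>\<zeta> \<equiv> p\<^sup>a \<tau>\<close>
  modulo \<open>k\<^sub>p\<close>, so \<open>\<theta>\<^sup>\<zeta>\<close> is a conjugate of \<open>u\<close>.
\<close>

section \<open>Reindexing, Stirling numbers and summation by parts\<close>

text \<open>Multiplication by \<open>a\<close> permutes the residues modulo \<open>p\<close>. This
  allows sums over all Frobenius powers to be indexed by the powers of the \<open>a\<close>-th
  one.\<close>

lemma sum_multiples_mod:
  fixes f :: "nat \<Rightarrow> 'b :: comm_monoid_add"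
  assumes "coprime a p" "p > 0" and f: "\<And>n. f (n mod p) = f n"
  shows   "(\<Sum>j<p. f (j * a)) = (\<Sum>i<p. f i)"
proof -
  have inj: "inj_on (\<lambda>j. j * a mod p) {..<p}"
  proof (rule inj_onI)
    fix i j assume *: "i \<in> {..<p}" "j \<in> {..<p}" "i * a mod p = j * a mod p"
    hence "[i = j] (mod p)"
      using cong_mult_rcancel_nat[OF \<open>coprime a p\<close>] by (simp add: cong_def)
    thus "i = j" using * by (simp add: cong_def)
  qed
  have "(\<lambda>j. j * a mod p) ` {..<p} = {..<p}"
    using inj \<open>p > 0\<close> by (intro endo_inj_surj) auto
  hence "bij_betw (\<lambda>j. j * a mod p) {..<p} {..<p}"
    using inj by (simp add: bij_betw_def)
  from sum.reindex_bij_betw[OF this, of f] show ?thesis by (simp add: f)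
qed

text \<open>Homogenized expansion of powers in falling factorials, with step \<open>a\<close>
  instead of \<open>1\<close>. The relation \<open>x * N j = N (Suc j) + j * a * N j\<close> matches
  the Stirling recurrence.\<close>

lemma power_eq_sum_Stirling_prod:
  fixes x a :: "'b :: comm_ring_1"
  shows "x ^ m = (\<Sum>j\<le>m. of_nat (Stirling m j) * a ^ (m - j) * (\<Prod>i<j. x - of_nat i * a))"
proof (induction m)
  case 0
  show ?case by simp
next
  case (Suc m)
  define N where "N j = (\<Prod>i<j. x - of_nat i * a)" for j
  have xN: "x * (c * N j) = c * N (Suc j) + c * (of_nat j * a * N j)" for c j
    by (simp add: N_def algebra_simps)
  have "(\<Sum>j\<le>Suc m. of_nat (Stirling (Suc m) j) * a ^ (Suc m - j) * N j) =
          (\<Sum>j\<le>m. of_nat (Stirling (Suc m) (Suc j)) * a ^ (m - j) * N (Suc j))"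
    by (subst sum.atMost_Suc_shift) simp
  also have "\<dots> = (\<Sum>j\<le>m. of_nat (Stirling m j) * a ^ (m - j) * N (Suc j)) +
                  (\<Sum>j\<le>m. of_nat (Suc j * Stirling m (Suc j)) * a ^ (m - j) * N (Suc j))"
    by (simp add: algebra_simps flip: sum.distrib)
  \<comment> \<open>The shift adds a term at \<open>j = 0\<close>, killed by the factor
    \<open>j\<close>; the top term is then dropped because
    \<open>Stirling m (Suc m) = 0\<close>.\<close>
  also have "(\<Sum>j\<le>m. of_nat (Suc j * Stirling m (Suc j)) * a ^ (m - j) * N (Suc j)) =
             (\<Sum>j\<le>Suc m. of_nat (j * Stirling m j) * a ^ (Suc m - j) * N j)"
    by (simp only: sum.atMost_Suc_shift) simp
  also have "\<dots> = (\<Sum>j\<le>m. of_nat (j * Stirling m j) * a ^ (Suc m - j) * N j)"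
    by simp
  also have "\<dots> = (\<Sum>j\<le>m. of_nat (Stirling m j) * a ^ (m - j) * (of_nat j * a * N j))"
    by (intro sum.cong) (auto simp: Suc_diff_le algebra_simps)
  also have "(\<Sum>j\<le>m. of_nat (Stirling m j) * a ^ (m - j) * N (Suc j)) + \<dots> =
             x * (\<Sum>j\<le>m. of_nat (Stirling m j) * a ^ (m - j) * N j)"
    by (simp only: sum_distrib_left xN sum.distrib)
  also have "\<dots> = x ^ Suc m"
    using Suc.IH by (simp add: N_def)
  finally show ?case by (simp add: N_def)
qed

lemma poly_bell_poly:
  fixes x :: "'b :: comm_ring_1"
  shows "poly (map_poly of_int (bell_poly m)) x = (\<Sum>j\<le>m. of_nat (Stirling m j) * x ^ j)"
proof -
  have "map_poly of_int (bell_poly m) = (\<Sum>j\<le>m. monom (of_nat (Stirling m j) :: 'b) j)"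
    by (intro poly_eqI) (simp add: coeff_map_poly coeff_bell_poly coeff_sum)
  thus ?thesis by (simp add: poly_sum poly_monom)
qed

lemma sum_mult_forward_difference:
  fixes e :: "nat \<Rightarrow> 'b :: comm_ring_1"
  shows "(\<Sum>j=1..n. of_nat j * (e (Suc j) - e j)) = of_nat (Suc n) * e (Suc n) - (\<Sum>j=1..Suc n. e j)"
  by (induction n) (simp_all add: algebra_simps)

section \<open>Congruences for \<open>tau\<close> and \<open>zeta\<close> modulo
  \<open>kp p\<close>\<close>

lemma cong_power_p_kp:
  assumes p: "prime p"
  shows   "[int p ^ p = 1] (mod kp p)"
proof -
  have "int p ^ p - 1 = (int p - 1) * kp p"
    unfolding kp_eq_sum[OF prime_gt_1_nat[OF p]] by (rule power_diff_1_eq)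
  thus ?thesis by (simp add: cong_iff_dvd_diff)
qed

lemma cong_power_mod_kp:
  assumes p: "prime p"
  shows   "[int p ^ (n mod p) = int p ^ n] (mod kp p)"
proof -
  have "[(int p ^ p) ^ (n div p) * int p ^ (n mod p) = 1 ^ (n div p) * int p ^ (n mod p)] (mod kp p)"
    by (intro cong_mult cong_pow cong_power_p_kp[OF p] cong_refl)
  also have "(int p ^ p) ^ (n div p) * int p ^ (n mod p) = int p ^ n"
    by (simp flip: power_mult power_add)
  finally show ?thesis by (simp add: cong_sym_eq)
qed

context
  fixes p a :: nat
  assumes p: "prime p" and a: "coprime a p"
begin

lemma tau_cong: "[int (tau p a) * (int p ^ a - 1) = 1] (mod kp p)"
proof -
  define e where "e j = int p ^ (j * a - 1)" for j
  have p1: "p > 1" using p prime_gt_1_nat by blast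
  have a0: "a > 0" using a p1 by (cases "a = 0") auto
  \<comment> \<open>At \<open>j = 0\<close> the truncated exponent \<open>j * a - 1\<close> is
    \<open>0\<close> and the recurrence fails.\<close>
  have e_Suc: "e (Suc j) = int p ^ a * e j" if "j \<ge> 1" for j
    using that a0 unfolding e_def by (simp flip: power_add)
  have pe: "int p * e j = int p ^ (j * a)" if "j \<ge> 1" for j
    using that a0 unfolding e_def by (simp flip: power_Suc)
  have "int (tau p a) * (int p ^ a - 1) = (\<Sum>j=1..p-1. int j * (e (Suc j) - e j))"
    unfolding tau_def of_nat_sum sum_distrib_right
    by (intro sum.cong) (auto simp: e_Suc algebra_simps, auto simp: e_def)
  also have "\<dots> = int p * e p - (\<Sum>j=1..p. e j)"
    using sum_mult_forward_difference[of e "p - 1"] p1 by simp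
  finally have eq: "int (tau p a) * (int p ^ a - 1) = int p * e p - (\<Sum>j=1..p. e j)" .
  have "[(int p ^ p) ^ a = 1 ^ a] (mod kp p)"
    by (intro cong_pow cong_power_p_kp[OF p])
  hence pa: "[int p ^ (p * a) = 1] (mod kp p)" by (simp add: power_mult)
  \<comment> \<open>Powers of \<open>p\<close> depend only on the exponent modulo \<open>p\<close>,
    so the multiples of \<open>a\<close> yield the sum of all \<open>p ^ i\<close>, which is
    \<open>kp p\<close>.\<close>
  have "(\<Sum>j<p. int p ^ (j * a) mod kp p) = (\<Sum>i<p. int p ^ i mod kp p)"
    using cong_power_mod_kp[OF p] p1 a by (intro sum_multiples_mod) (auto simp: cong_def)
  hence "[(\<Sum>j<p. int p ^ (j * a)) = (\<Sum>i<p. int p ^ i)] (mod kp p)"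
    unfolding cong_def by (metis mod_sum_eq)
  also have "(\<Sum>i<p. int p ^ i) = kp p" by (rule kp_eq_sum[OF p1, symmetric])
  finally have sum0: "[(\<Sum>j<p. int p ^ (j * a)) = 0] (mod kp p)"
    by (simp add: cong_def)
  \<comment> \<open>The unit \<open>p\<close> cancels the \<open>- 1\<close> in the exponents;
    moving the range from \<open>1..p\<close> to \<open>0..p-1\<close> costs
    \<open>p ^ (p * a) - 1\<close>, which is \<open>0\<close> modulo \<open>kp p\<close>.\<close>
  have "(\<Sum>j=1..p. int p * e j) = (\<Sum>j=1..p. int p ^ (j * a))"
    by (intro sum.cong) (auto simp: pe)
  also have "\<dots> = (\<Sum>j<p. int p ^ (j * a)) + (int p ^ (p * a) - 1)"
    using sum.lessThan_Suc[of "\<lambda>j. int p ^ (j * a)" p]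
    by (subst (asm) sum.lessThan_Suc_shift) (simp add: sum.atLeast1_atMost_eq)
  also have "[\<dots> = 0 + (1 - 1)] (mod kp p)"
    by (intro cong_add cong_diff sum0 pa cong_refl)
  finally have "[int p * (\<Sum>j=1..p. e j) = int p * 0] (mod kp p)"
    by (simp add: sum_distrib_left)
  hence "[(\<Sum>j=1..p. e j) = 0] (mod kp p)"
    using coprime_p_kp[OF p1] by (metis cong_mult_lcancel)
  hence "[int p * e p - (\<Sum>j=1..p. e j) = 1 - 0] (mod kp p)"
    using pa pe[of p] p1 by (intro cong_diff) auto
  thus ?thesis unfolding eq by simp
qed

text \<open>Since \<open>1 - P ^ a = P ^ a * (q - 1)\<close> modulo \<open>kp p\<close>, with
  \<open>q\<close> inverse to \<open>P ^ a\<close> and \<open>tau p a\<close> inverse to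
  \<open>q - 1\<close>, the inverse is \<open>q * tau p a\<close>.\<close>

lemma zeta_cong: "[zeta p a = int p ^ a * int (tau p a)] (mod kp p)"
proof -
  define P where "P = modular_inverse (kp p) (int p)"
  define z t q where "z = zeta p a" and "t = int (tau p a)" and "q = int p ^ a"
  have "[int p * P = 1] (mod kp p)"
    unfolding P_def
    by (rule cong_modular_inverse1[OF coprime_p_kp[OF prime_gt_1_nat[OF p]]])
  hence "[(int p * P) ^ a = 1 ^ a] (mod kp p)" by (rule cong_pow)
  hence qP: "[q * P ^ a = 1] (mod kp p)" by (simp add: power_mult_distrib q_def)
  have t: "[t * (q - 1) = 1] (mod kp p)"
    using tau_cong by (simp add: t_def q_def)
  have "[z * (t * (q - q * P ^ a)) = z * (t * (q - 1))] (mod kp p)"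
    by (intro cong_mult cong_diff cong_refl qP)
  also have "[z * (t * (q - 1)) = z * 1] (mod kp p)"
    by (intro cong_mult cong_refl t)
  also have "z * (t * (q - q * P ^ a)) = q * t * ((1 - P ^ a) * z)"
    by (simp add: algebra_simps)
  finally have "[z = q * t * ((1 - P ^ a) * z)] (mod kp p)" by (simp add: cong_sym_eq)
  also have "[q * t * ((1 - P ^ a) * z) = q * t * 1] (mod kp p)"
    unfolding P_def z_def by (intro cong_mult cong_refl zeta_mult_eq_1[OF p a])
  finally show ?thesis by (simp add: z_def q_def t_def)
qed

end

section \<open>Frobenius, trace and norm in the Artin-Schreier extension\<close>

locale artin_schreier =
  fixes p :: nat and \<theta> :: "'a :: finite_field"
  assumes p: "prime p"
    and card: "card (UNIV :: 'a set) = p ^ p"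
    and theta: "\<theta> ^ p = \<theta> + 1"
begin

lemma char: "CHAR('a) = p"
  by (rule CHAR_eq_if_card[OF p card])

lemma of_nat_p [simp]: "(of_nat p :: 'a) = 0"
  using of_nat_CHAR[where 'a = 'a] char by simp

lemma of_nat_eq_0_iff_dvd: "(of_nat n :: 'a) = 0 \<longleftrightarrow> p dvd n"
  using of_nat_eq_0_iff_char_dvd[where 'a = 'a] char by simp

lemma p_gt_1: "p > 1"
  using p prime_gt_1_nat by blast

lemma theta_nonzero [simp]: "\<theta> \<noteq> 0"
  using theta p_gt_1 by (auto simp: power_0_left)

lemma power_add_frobenius: "(x + y :: 'a) ^ (p ^ n) = x ^ (p ^ n) + y ^ (p ^ n)"
  using p char by (intro freshmans_dream') auto

lemma power_power_card_mod: "(x :: 'a) ^ (p ^ (n mod p)) = x ^ (p ^ n)"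
proof -
  have 1: "y ^ (p ^ p) ^ k = y" for y :: 'a and k
    by (induction k) (use finite_field_power_card_eq_same[of y] card in \<open>auto simp: power_mult\<close>)
  have "p ^ n = (p ^ p) ^ (n div p) * p ^ (n mod p)"
    by (simp flip: power_mult power_add)
  thus ?thesis by (simp add: power_mult 1)
qed

lemma theta_conjugate: "\<theta> ^ (p ^ n) = \<theta> + of_nat n"
proof (induction n)
  case (Suc n)
  have "\<theta> ^ (p ^ Suc n) = (\<theta> ^ p) ^ (p ^ n)" by (simp flip: power_mult)
  also have "\<dots> = \<theta> + of_nat (Suc n)"
    by (simp add: theta power_add_frobenius Suc algebra_simps)
  finally show ?case .
qed simp

lemma theta_plus_conjugate: "(\<theta> + of_nat k) ^ (p ^ n) = \<theta> + of_nat (k + n)"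
proof -
  have "(\<theta> + of_nat k) ^ (p ^ n) = \<theta> ^ (p ^ (k + n))"
    by (simp only: power_add power_mult theta_conjugate)
  thus ?thesis by (simp only: theta_conjugate)
qed

lemma Tr_add: "Tr p (x + y :: 'a) = Tr p x + Tr p y"
  by (simp add: Tr_def power_add_frobenius sum.distrib)

lemma Tr_0 [simp]: "Tr p (0 :: 'a) = 0"
  using p_gt_1 by (simp add: Tr_def power_0_left)

lemma Tr_diff: "Tr p (x - y :: 'a) = Tr p x - Tr p y"
  using Tr_add[of "x - y" y] by simp

lemma Tr_sum: "Tr p (sum f A :: 'a) = (\<Sum>x\<in>A. Tr p (f x))"
  by (induction A rule: infinite_finite_induct) (auto simp: Tr_add)

lemma Tr_of_nat_mult: "Tr p (of_nat n * x :: 'a) = of_nat n * Tr p x"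
  by (induction n) (auto simp: Tr_add algebra_simps)

text \<open>A trace is some \<open>of_nat n\<close>, hence a scalar for the trace.\<close>

lemma Tr_Tr_mult: "Tr p (Tr p x * y :: 'a) = Tr p x * Tr p y"
  using Tr_in_prime_subfield[OF p card, of x] by (auto simp: Tr_of_nat_mult)

lemma Tr_eq_sum_multiples: "coprime a p \<Longrightarrow> Tr p (x :: 'a) = (\<Sum>j<p. x ^ (p ^ (j * a)))"
  unfolding Tr_def
  using sum_multiples_mod[of a p "\<lambda>n. x ^ (p ^ n)"] p_gt_1 power_power_card_mod by simp

lemma Tr_power_frobenius: "Tr p (x ^ (p ^ n) :: 'a) = Tr p x"
proof (induction n)
  case (Suc n)
  define y where "y = x ^ (p ^ n)"
  have "Tr p (y ^ p) = (\<Sum>i<p. y ^ (p ^ Suc i))"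
    by (simp add: Tr_def flip: power_mult)
  also have "\<dots> = Tr p y + y ^ (p ^ p) - y"
    using sum.lessThan_Suc_shift[of "\<lambda>i. y ^ (p ^ i)" p]
          sum.lessThan_Suc[of "\<lambda>i. y ^ (p ^ i)" p]
    unfolding Tr_def by (simp add: algebra_simps del: power_Suc)
  also have "\<dots> = Tr p y"
    using finite_field_power_card_eq_same[of y] card by simp
  finally show ?case
    using Suc by (simp add: y_def mult.commute flip: power_mult)
qed simp

text \<open>Both sides have degree at most \<open>p\<close>, the same coefficient at
  \<open>p\<close>, and vanish at the \<open>p\<close> distinct points
  \<open>- of_nat k\<close>.\<close>

lemma prod_linear_poly:
  "(\<Prod>k<p. [:of_nat k, 1:] :: 'a poly) = monom 1 p - monom 1 1"
proof (rule poly_eqI_degree_lead_coeff[where n = p and A = "(\<lambda>k. - of_nat k) ` {..<p}"])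
  have inj: "inj_on (\<lambda>k. - of_nat k :: 'a) {..<p}"
    by (auto intro!: inj_onI simp: of_nat_eq_iff_cong_CHAR char cong_def)
  show "p \<le> card ((\<lambda>k. - of_nat k :: 'a) ` {..<p})"
    by (simp add: card_image[OF inj])
  have deg: "degree (\<Prod>k<p. [:of_nat k, 1:] :: 'a poly) = p"
    by (subst degree_prod_sum_eq) auto
  thus "degree (\<Prod>k<p. [:of_nat k, 1:] :: 'a poly) \<le> p" by simp
  have "lead_coeff (\<Prod>k<p. [:of_nat k, 1:] :: 'a poly) = 1"
    by (simp add: lead_coeff_prod)
  thus "coeff (\<Prod>k<p. [:of_nat k, 1:] :: 'a poly) p = coeff (monom 1 p - monom 1 1) p"
    using p_gt_1 deg by simp
  show "degree (monom 1 p - monom 1 1 :: 'a poly) \<le> p"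
    using p_gt_1 by (intro degree_diff_le) (auto simp: degree_monom_eq)
next
  fix z :: 'a
  assume "z \<in> (\<lambda>k. - of_nat k) ` {..<p}"
  then obtain k where k: "k < p" "z = - of_nat k" by auto
  have "(of_nat n :: 'a) ^ p = of_nat n" for n
    using p char p_gt_1 by (induction n) (auto simp: freshmans_dream power_0_left)
  moreover have "(- of_nat k + of_nat k :: 'a) ^ p = (- of_nat k) ^ p + of_nat k ^ p"
    using p char by (intro freshmans_dream) auto
  ultimately have "(- of_nat k) ^ p = (- of_nat k :: 'a)"
    using p_gt_1 by (simp add: power_0_left eq_neg_iff_add_eq_0)
  hence "z ^ p = z" by (simp only: k(2))
  moreover have "(\<Prod>k<p. of_nat k + z) = 0"
    using k by (intro prod_zero) auto
  ultimately show "poly (\<Prod>k<p. [:of_nat k, 1:]) z = poly (monom 1 p - monom 1 1) z"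
    by (simp add: poly_prod poly_monom)
qed

lemma norm_theta: "(\<Prod>k<p. \<theta> + of_nat k) = 1"
  using arg_cong[OF prod_linear_poly, of "\<lambda>f. poly f \<theta>"]
  by (simp add: poly_prod poly_monom theta add.commute)

text \<open>The logarithmic derivative of \<open>X\<^sup>p - X = (\<Prod>k<p. X + k)\<close> at \<open>\<theta>\<close> is \<open>-1\<close>.\<close>

lemma Tr_inverse_theta: "Tr p (inverse \<theta>) = - 1"
proof -
  have "Tr p (inverse \<theta>) = (\<Sum>k<p. inverse (\<theta> + of_nat k))"
    by (simp only: Tr_def power_inverse theta_conjugate)
  also have "\<dots> = (\<Sum>k<p. \<Prod>j\<in>{..<p}-{k}. \<theta> + of_nat j)"
  proof (intro sum.cong refl)
    fix k assume "k \<in> {..<p}"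
    hence "(\<theta> + of_nat k) * (\<Prod>j\<in>{..<p}-{k}. \<theta> + of_nat j) = 1"
      using prod.remove[of "{..<p}" k "\<lambda>j. \<theta> + of_nat j"] norm_theta by simp
    thus "inverse (\<theta> + of_nat k) = (\<Prod>j\<in>{..<p}-{k}. \<theta> + of_nat j)"
      by (rule inverse_unique)
  qed
  also have "\<dots> = poly (pderiv (\<Prod>k<p. [:of_nat k, 1:])) \<theta>"
    by (simp add: pderiv_prod poly_sum poly_prod pderiv_pCons add.commute)
  also have "\<dots> = - 1"
    by (simp add: prod_linear_poly pderiv_diff pderiv_monom poly_monom)
  finally show ?thesis .
qed

text \<open>As \<open>kp p\<close> is the sum of the \<open>p ^ i\<close>, this power is the norm of
  \<theta>.\<close>

lemma theta_power_kp: "\<theta> powi kp p = 1"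
proof -
  have "kp p = int (\<Sum>i<p. p ^ i)"
    using kp_eq_sum[OF p_gt_1] by simp
  hence "\<theta> powi kp p = (\<Prod>i<p. \<theta> ^ (p ^ i))"
    by (simp only: power_int_of_nat power_sum)
  also have "\<dots> = 1"
    by (simp add: theta_conjugate norm_theta)
  finally show ?thesis .
qed

lemma theta_powi_cong:
  assumes "[x = y] (mod kp p)"
  shows   "\<theta> powi x = \<theta> powi y"
proof -
  obtain k where "y = x + kp p * k"
    using assms by (metis cong_iff_lin)
  thus ?thesis by (simp add: power_int_add power_int_mult theta_power_kp)
qed

section \<open>Traces involving \<open>u\<close> and the Bell polynomials\<close>

definition u :: "nat \<Rightarrow> 'a" where "u a = \<theta> ^ tau p a"

lemma u_nonzero [simp]: "u a \<noteq> 0"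
  by (simp add: u_def)

context
  fixes a :: nat
  assumes a: "coprime a p"
begin

lemma Tr_shifted_prod_eq_0:
  assumes "Suc n < p"
  shows   "Tr p (\<Prod>i<n. \<theta> + of_nat (Suc i * a)) = 0"
proof -
  define G where "G n = (\<Prod>i<n. \<theta> + of_nat (Suc i * a))" for n
  define H where "H n = (\<Prod>i<n. \<theta> + of_nat (i * a))" for n
  have "H (Suc n) ^ (p ^ a) = G (Suc n)"
    unfolding H_def G_def
    by (simp only: prod_power_distrib theta_plus_conjugate mult_Suc add.commute)
  hence "Tr p (G (Suc n) - H (Suc n)) = 0"
    using Tr_power_frobenius[of "H (Suc n)" a] by (simp add: Tr_diff)
  moreover have "H (Suc n) = \<theta> * G n"
    unfolding H_def G_def by (subst prod.lessThan_Suc_shift) simp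
  hence "G (Suc n) - H (Suc n) = of_nat (Suc n * a) * G n"
    by (simp add: G_def algebra_simps)
  \<comment> \<open>The bound \<open>Suc n < p\<close> makes the scalar in
    \<open>G (Suc n) - H (Suc n)\<close> invertible.\<close>
  moreover have "\<not> p dvd Suc n * a"
    using assms a by (metis coprime_commute coprime_dvd_mult_left_iff dvd_imp_le not_less zero_less_Suc)
  hence "(of_nat (Suc n * a) :: 'a) \<noteq> 0"
    by (simp only: of_nat_eq_0_iff_dvd not_False_eq_True)
  ultimately have "Tr p (G n) = 0"
    by (simp only: Tr_of_nat_mult mult_eq_0_iff simp_thms)
  thus ?thesis by (simp only: G_def)
qed

lemma u_power: "u a ^ (p ^ a) = u a * \<theta>"
proof -
  have "[int (tau p a) * (int p ^ a - 1) + int (tau p a) = 1 + int (tau p a)] (mod kp p)"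
    by (intro cong_add tau_cong[OF p a] cong_refl)
  hence "\<theta> powi (int (tau p a * p ^ a)) = \<theta> powi (int (Suc (tau p a)))"
    by (intro theta_powi_cong) (simp add: algebra_simps)
  thus ?thesis
    by (simp only: power_int_of_nat u_def power_mult power_Suc2)
qed

lemma u_conjugate: "u a ^ (p ^ (j * a)) = u a * (\<Prod>i<j. \<theta> + of_nat (i * a))"
proof (induction j)
  case (Suc j)
  have "u a ^ (p ^ (Suc j * a)) = (u a ^ (p ^ a)) ^ (p ^ (j * a))"
    by (simp add: power_add flip: power_mult)
  also have "\<dots> = u a ^ (p ^ (j * a)) * (\<theta> + of_nat (j * a))"
    by (simp only: u_power power_mult_distrib theta_conjugate)
  finally show ?case by (simp add: Suc)
qed simp

lemma Tr_u_mult_Tr: "Tr p (u a) * Tr p (1 / (u a * \<theta>)) = - 1"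
proof -
  define H where "H n = (\<Prod>i<n. \<theta> + of_nat (i * a))" for n
  have H_Suc: "H (Suc n) = \<theta> * (\<Prod>i<n. \<theta> + of_nat (Suc i * a))" for n
    unfolding H_def by (subst prod.lessThan_Suc_shift) simp
  \<comment> \<open>Once \<open>Tr p (u a)\<close> is inside the other trace, its conjugate
    expansion cancels \<open>u a\<close>.\<close>
  have "Tr p (u a) * Tr p (1 / (u a * \<theta>)) = Tr p (Tr p (u a) * (1 / (u a * \<theta>)))"
    by (rule Tr_Tr_mult [symmetric])
  also have "Tr p (u a) * (1 / (u a * \<theta>)) = (\<Sum>j<p. u a * H j) * (1 / (u a * \<theta>))"
    by (simp only: Tr_eq_sum_multiples[OF a] u_conjugate H_def)
  also have "\<dots> = (\<Sum>j<p. H j / \<theta>)"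
    unfolding sum_distrib_right by simp
  also have "Tr p \<dots> = (\<Sum>j<p. Tr p (H j / \<theta>))"
    by (rule Tr_sum)
  also have "\<dots> = (\<Sum>j<Suc (p - 1). Tr p (H j / \<theta>))"
    using p_gt_1 by simp
  \<comment> \<open>For positive index the leading factor \<theta> of \<open>H\<close> cancels and
    leaves a shifted product of trace \<open>0\<close>; only \<open>H 0 = 1\<close>
    contributes.\<close>
  also have "\<dots> = Tr p (H 0 / \<theta>) + (\<Sum>j<p-1. Tr p (H (Suc j) / \<theta>))"
    by (rule sum.lessThan_Suc_shift)
  also have "(\<Sum>j<p-1. Tr p (H (Suc j) / \<theta>)) = 0"
    unfolding H_Suc using Tr_shifted_prod_eq_0 by (intro sum.neutral) auto
  also have "H 0 / \<theta> = inverse \<theta>"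
    by (simp add: H_def divide_inverse)
  finally show ?thesis by (simp add: Tr_inverse_theta)
qed

text \<open>
  The functional \<open>x \<mapsto> Tr (x / (u \<theta>))\<close> satisfies the twisted invariance that characterises the
  umbral map \<open>\<theta>\<^sup>m \<mapsto> a\<^sup>m b\<^sub>m(a\<^sup>-\<^sup>1)\<close> up to a scalar factor.
\<close>

lemma Tr_theta_mult: "Tr p (\<theta> * x / (u a * \<theta>)) = Tr p (x ^ (p ^ a) / (u a * \<theta>))"
proof -
  have "Tr p (x ^ (p ^ a) / (u a * \<theta>)) = Tr p ((x / u a) ^ (p ^ a))"
    by (simp add: power_divide u_power)
  thus ?thesis by (simp add: Tr_power_frobenius)
qed

text \<open>The Frobenius power adds \<open>a\<close> to each factor of \<open>x\<close>, so twisted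
  invariance trades the leading \<theta> for a product with one factor less.\<close>

lemma Tr_falling_prod:
  "Tr p ((\<Prod>i<j. \<theta> - of_nat i * of_nat a) / (u a * \<theta>)) = Tr p (1 / (u a * \<theta>))"
proof (induction j)
  case (Suc j)
  define x where "x = (\<Prod>i<j. \<theta> - of_nat (Suc i) * of_nat a)"
  have "(\<theta> - of_nat (Suc i) * of_nat a) ^ (p ^ a) = \<theta> - of_nat i * of_nat a" for i
  proof -
    \<comment> \<open>A natural number congruent to \<open>- (Suc i * a)\<close> modulo
      \<open>p\<close>, as \<open>theta_plus_conjugate\<close> shifts by naturals.\<close>
    define c :: nat where "c = (p - 1) * Suc i * a"
    have c: "(of_nat c :: 'a) = - (of_nat (Suc i) * of_nat a)"
    proof -
      have "c + Suc i * a = p * (Suc i * a)"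
        using p_gt_1 by (cases p) (simp_all add: c_def algebra_simps)
      hence "(of_nat (c + Suc i * a) :: 'a) = 0" by (simp del: of_nat_add)
      thus ?thesis by (simp add: eq_neg_iff_add_eq_0 algebra_simps)
    qed
    show ?thesis
      using theta_plus_conjugate[of c a] by (simp add: c algebra_simps)
  qed
  hence "x ^ (p ^ a) = (\<Prod>i<j. \<theta> - of_nat i * of_nat a)"
    by (simp add: x_def prod_power_distrib del: of_nat_Suc)
  moreover have "(\<Prod>i<Suc j. \<theta> - of_nat i * of_nat a) = \<theta> * x"
    unfolding x_def by (subst prod.lessThan_Suc_shift) simp
  ultimately show ?case using Tr_theta_mult[of x] Suc by simp
qed simp

lemma Tr_power_eq_bell_poly:
  "of_nat a ^ m * poly (map_poly of_int (bell_poly m)) (inverse (of_nat a)) =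
     - Tr p (u a) * Tr p (\<theta> ^ m / (u a * \<theta>))"
proof -
  have a0: "(of_nat a :: 'a) \<noteq> 0"
    using a p_gt_1 of_nat_eq_0_iff_dvd by (metis coprime_absorb_right nat_dvd_1_iff_1 less_irrefl)
  define N where "N j = (\<Prod>i<j. \<theta> - of_nat i * of_nat a)" for j
  have "\<theta> ^ m / (u a * \<theta>) = (\<Sum>j\<le>m. of_nat (Stirling m j * a ^ (m - j)) * (N j / (u a * \<theta>)))"
    by (subst power_eq_sum_Stirling_prod[where a = "of_nat a"])
       (simp add: N_def sum_divide_distrib)
  hence "- Tr p (u a) * Tr p (\<theta> ^ m / (u a * \<theta>)) =
           (\<Sum>j\<le>m. of_nat (Stirling m j * a ^ (m - j)) * - (Tr p (u a) * Tr p (1 / (u a * \<theta>))))"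
    by (simp only: Tr_sum Tr_of_nat_mult Tr_falling_prod N_def sum_distrib_left)
       (simp add: mult_ac)
  also have "\<dots> = (\<Sum>j\<le>m. of_nat (Stirling m j) * of_nat a ^ (m - j))"
    by (simp add: Tr_u_mult_Tr)
  also have "\<dots> = (\<Sum>j\<le>m. of_nat a ^ m * (of_nat (Stirling m j) * inverse (of_nat a) ^ j))"
    using a0 by (intro sum.cong) (auto simp: power_diff field_simps)
  also have "\<dots> = of_nat a ^ m * poly (map_poly of_int (bell_poly m)) (inverse (of_nat a))"
    by (simp add: poly_bell_poly sum_distrib_left)
  finally show ?thesis by simp
qed

end

end

theorem theorem1p2:
  fixes p a m :: nat and \<theta> :: "'a :: finite_field"
  assumes "prime p"
    and "card (UNIV :: 'a set) = p ^ p"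
    and "\<theta> ^ p = \<theta> + 1"
    and "gcd a p = 1"
  shows "of_nat a ^ m * poly (map_poly of_int (bell_poly m)) (inverse (of_nat a)) =
           - Tr p (\<theta> ^ tau p a) * Tr p (\<theta> powi (int m - 1 - int (tau p a)))
         \<and> (\<forall>Z. [Z = zeta p a] (mod kp p) \<longrightarrow> Tr p (\<theta> powi Z) = Tr p (\<theta> ^ tau p a))
         \<and> Tr p (\<theta> ^ tau p a) =
           of_nat a ^ tau p a * poly (map_poly of_int (bell_poly (tau p a))) (inverse (of_nat a))"
proof -
  interpret artin_schreier p \<theta>
    by (rule artin_schreier.intro[OF assms(1-3)])
  have a: "coprime a p"
    using assms(4) by (simp only: coprime_iff_gcd_eq_1)
  have powi: "\<theta> powi (int m - 1 - int (tau p a)) = \<theta> ^ m / (u a * \<theta>)"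
    by (simp add: power_int_diff u_def)
  have Tr_powi: "Tr p (\<theta> powi Z) = Tr p (u a)" if "[Z = zeta p a] (mod kp p)" for Z
  proof -
    have "\<theta> powi Z = \<theta> powi (int (tau p a * p ^ a))"
      using cong_trans[OF that zeta_cong[OF assms(1) a]]
      by (intro theta_powi_cong) (simp add: mult.commute)
    also have "\<dots> = u a ^ (p ^ a)"
      by (simp only: power_int_of_nat power_mult u_def)
    finally show ?thesis by (simp only: Tr_power_frobenius)
  qed
  \<comment> \<open>For \<open>m = tau p a\<close> the second trace is that of
    \<open>inverse \<theta>\<close>, and its value \<open>- 1\<close> cancels the sign.\<close>
  have "\<theta> ^ tau p a / (u a * \<theta>) = inverse \<theta>"
    by (simp add: u_def inverse_eq_divide)
  hence "Tr p (u a) = - Tr p (u a) * Tr p (\<theta> ^ tau p a / (u a * \<theta>))"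
    by (simp only: Tr_inverse_theta) simp
  thus ?thesis
    using Tr_powi unfolding Tr_power_eq_bell_poly[OF a] powi u_def by blast
qed

end
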